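(* Let $\lambda>0$ and $\Omega_\lambda=\{x\in\mathbb{R}^2:\ \|x\|<1/\lambda\}$. Let $Q=(a,b)\in\Omega_\lambda$, let $s=\{(x,y)\in\mathbb{R}^2:\ y=mx+c\}$ (with $m,c\in\mathbb{R}$) be a line that meets $\Omega_\lambda$, and let $\theta=\arctan m$. Put $$r=\frac{1-\lambda^2c\cos\theta\,(b\cos\theta-a\sin\theta)+\lambda\,|c\cos\theta-b\cos\theta+a\sin\theta|}{1-\lambda^2(b\cos\theta-a\sin\theta)^2}.$$ Then the $\lambda$-Funk distance from the line $s$ to the point $Q$ is $$d_F(s,Q)=\frac{\ln r}{\lambda},$$ and this distance is realized by the point $$P^*=\begin{pmatrix}\cos\theta&-\sin\theta\\ \sin\theta&\cos\theta\end{pmatrix}\begin{pmatrix}a r\cos\theta+b r\sin\theta\\ c\cos\theta\end{pmatrix}.$$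
   Context: $\langle\cdot,\cdot\rangle$ and $\|\cdot\|$ denote the usual Euclidean inner product and norm on $\mathbb{R}^2$. For $\lambda>0$ the $\lambda$-Funk metric is the function $F:\Omega_\lambda\times\mathbb{R}^2\to\mathbb{R}$, $$F(x,y)=\frac{\sqrt{\lambda^2\langle x,y\rangle^2+\|y\|^2(1-\lambda^2\|x\|^2)}}{1-\lambda^2\|x\|^2}+\frac{\lambda\langle x,y\rangle}{1-\lambda^2\|x\|^2}.$$ For a piecewise regular curve $\gamma:[\alpha,\beta]\to\Omega_\lambda$, its Finsler arc length is $\mathscr{L}_F(\gamma)=\int_\alpha^\beta F(\gamma(t),\gamma'(t))\,dt$. The induced distance from $P$ to $Q$ is $d_F(P,Q)=\inf_\gamma\mathscr{L}_F(\gamma)$, the infimum being taken over all piecewise regular curves $\gamma:[\alpha,\beta]\to\Omega_\lambda$ with $\gamma(\alpha)=P$ and $\gamma(\beta)=Q$; by convention $d_F(P,P)=0$. Note that $d_F$ need not be symmetric. The distance from a line $s$ to a point $Q\in\Omega_\lambda$ is $d_F(s,Q):=\min\{d_F(P',Q):\ P'\in s\}$, where $P'$ ranges over the points of $s$ lying in $\Omega_\lambda$ (where $d_F$ is defined). A point $P^*\in s$ (in $\Omega_\lambda$) realizes the distance from $s$ to $Q$ if $d_F(P^*,Q)\le d_F(P',Q)$ for all such $P'\in s$.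
   Formalization: The formal theorem also assumes that the minimum defining d_F(s,Q) is attained at some point of s in Ω_λ; without this the claim fails, e.g. λ=1, Q=(4/5,1/2), s the x-axis, where P*=(8/5,0) lies outside Ω_λ. *)

theory Defs
  imports "HOL-Analysis.Analysis"
begin

definition funk_domain :: "real \<Rightarrow> (real ^ 2) set" where
  "funk_domain lam = {x. norm x < 1 / lam}"

definition funk_metric :: "real \<Rightarrow> real ^ 2 \<Rightarrow> real ^ 2 \<Rightarrow> real" where
  "funk_metric lam x y =
     sqrt (lam\<^sup>2 * (x \<bullet> y)\<^sup>2 + (norm y)\<^sup>2 * (1 - lam\<^sup>2 * (norm x)\<^sup>2)) / (1 - lam\<^sup>2 * (norm x)\<^sup>2)
     + lam * (x \<bullet> y) / (1 - lam\<^sup>2 * (norm x)\<^sup>2)"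

definition regular_on :: "real \<Rightarrow> real \<Rightarrow> (real \<Rightarrow> real ^ 2) \<Rightarrow> bool" where
  "regular_on u v g \<longleftrightarrow>
     (\<exists>g'. continuous_on {u..v} g' \<and>
        (\<forall>t\<in>{u..v}. (g has_vector_derivative g' t) (at t within {u..v}) \<and> g' t \<noteq> 0))"

text \<open>Derivatives on each closed piece are one-sided at its end points, so they stay bounded
  near the corners, unlike in the library's \<open>piecewise_C1_differentiable_on\<close>. Continuity at the
  corners is implied, since consecutive pieces share their end points.\<close>

definition piecewise_regular_on :: "real \<Rightarrow> real \<Rightarrow> (real \<Rightarrow> real ^ 2) \<Rightarrow> bool" where
  "piecewise_regular_on \<alpha> \<beta> g \<longleftrightarrow> \<alpha> < \<beta> \<and>
     (\<exists>(n::nat) \<tau>. \<tau> 0 = \<alpha> \<and> \<tau> n = \<beta> \<and>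
        (\<forall>i<n. \<tau> i < \<tau> (Suc i) \<and> regular_on (\<tau> i) (\<tau> (Suc i)) g))"

text \<open>At the finitely many corners the integrand may have an unspecified value; this does not
  affect the integral.\<close>

definition funk_length :: "real \<Rightarrow> real \<Rightarrow> real \<Rightarrow> (real \<Rightarrow> real ^ 2) \<Rightarrow> real" where
  "funk_length lam \<alpha> \<beta> g =
     integral {\<alpha>..\<beta>} (\<lambda>t. funk_metric lam (g t) (vector_derivative g (at t within {\<alpha>..\<beta>})))"

definition funk_dist :: "real \<Rightarrow> real ^ 2 \<Rightarrow> real ^ 2 \<Rightarrow> real" where
  "funk_dist lam P Q =
     (if P = Q then 0
      else Inf {funk_length lam \<alpha> \<beta> g | \<alpha> \<beta> g.
             piecewise_regular_on \<alpha> \<beta> g \<and> g ` {\<alpha>..\<beta>} \<subseteq> funk_domain lam \<and> g \<alpha> = P \<and> g \<beta> = Q})"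

text \<open>The distance from a line is a minimum over an infinite set: \<open>LEAST\<close> yields the least element
  of that set if there is one, and is unspecified otherwise (it is not an infimum).\<close>

definition funk_dist_line :: "real \<Rightarrow> (real ^ 2) set \<Rightarrow> real ^ 2 \<Rightarrow> real" where
  "funk_dist_line lam s Q = (LEAST d. d \<in> (\<lambda>P. funk_dist lam P Q) ` (s \<inter> funk_domain lam))"

definition realizes_funk_dist_line :: "real \<Rightarrow> (real ^ 2) set \<Rightarrow> real ^ 2 \<Rightarrow> real ^ 2 \<Rightarrow> bool" where
  "realizes_funk_dist_line lam s Q P \<longleftrightarrow>
     P \<in> s \<inter> funk_domain lam \<and>
     (\<forall>P'\<in>s \<inter> funk_domain lam. funk_dist lam P Q \<le> funk_dist lam P' Q)"

end

theory Submission
  imports Defs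
begin

text \<open>
  Clearing the square root, \<open>F = funk_metric lam x y\<close> is the nonnegative solution of
  \<open>norm (y + (lam * F) *\<^sub>R x) = F\<close>: for \<open>y \<noteq> 0\<close>, the point \<open>x + y / (lam * F)\<close> is where the ray from
  \<open>x\<close> in direction \<open>y\<close> leaves the disc. Two consequences determine the distance.

  \<^item> Pairing this equation with a unit vector \<open>\<nu>\<close> gives \<open>F \<ge> (y \<bullet> \<nu>) / (1 - lam * (x \<bullet> \<nu>))\<close>. Along a
    curve the right-hand side is the derivative of \<open>- ln (1 - lam * (x \<bullet> \<nu>)) / lam\<close>, so every \<open>\<nu>\<close> yields
    a lower bound for the length that depends on the end points only (\<open>funk_length_ge\<close>).
  \<^item> A segment travelled towards a point \<open>w\<close> of the closed disc, so that the distance to \<open>w\<close> decays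
    like \<open>exp (- (lam * u))\<close>, has Funk speed at most 1 (\<open>homothety_curve_length_le\<close>).

  Together they say that, for \<open>R \<ge> 1\<close> and points of the open disc, the distance from \<open>P\<close> to \<open>Q\<close> is at most \<open>ln R / lam\<close> exactly when
  \<open>P\<close> lies in the Euclidean disc with centre \<open>R *\<^sub>R Q\<close> and radius \<open>(R - 1) / lam\<close>
  (\<open>funk_dist_le\<close>, \<open>norm_funk_dist_le\<close>). Growing \<open>R\<close> from 1, this disc first meets the line when it is
  tangent to it; this happens at \<open>R = r\<close> (\<open>funk_height_ratio\<close>), and the point of tangency is \<open>Pstar\<close>.

  The point of tangency can lie outside \<open>funk_domain lam\<close>. In that case there is no minimum:
  the discs depend on \<open>R\<close> in a convex way, so from any point of the chord the distance to \<open>Q\<close> decreases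
  strictly towards \<open>Pstar\<close>. Hence a minimizer, if there is one, must be \<open>Pstar\<close> itself
  (\<open>minimizer_at_tangency\<close>).
\<close>

section \<open>The Funk metric as the solution of a norm equation\<close>

lemma funk_domain_weight_pos:
  assumes "lam > 0" "x \<in> funk_domain lam"
  shows "1 - lam\<^sup>2 * (norm x)\<^sup>2 > 0"
proof -
  have "lam * norm x < 1"
    using assms by (simp add: funk_domain_def field_simps)
  then have "(lam * norm x)\<^sup>2 < 1\<^sup>2"
    using assms by (intro power_strict_mono) auto
  then show ?thesis by (simp add: power_mult_distrib)
qed

lemma funk_domain_inner_less:
  assumes "lam > 0" "x \<in> funk_domain lam" "norm \<nu> = 1"
  shows "lam * (x \<bullet> \<nu>) < 1"
proof -
  have "x \<bullet> \<nu> \<le> norm x"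
    using norm_cauchy_schwarz[of x \<nu>] assms(3) by simp
  also have "\<dots> < 1 / lam"
    using assms by (simp add: funk_domain_def)
  finally show ?thesis
    using assms(1) by (simp add: field_simps)
qed

text \<open>Both claims come from the quadratic equation \<open>D * F\<^sup>2 - 2 * p * F - (norm y)\<^sup>2 = 0\<close>, of which
  \<open>funk_metric\<close> is the larger root.\<close>

lemma funk_metric_nonneg_indicatrix:
  assumes "lam > 0" "x \<in> funk_domain lam"
  shows "funk_metric lam x y \<ge> 0"
    and "norm (y + (lam * funk_metric lam x y) *\<^sub>R x) = funk_metric lam x y"
proof -
  define D where "D = 1 - lam\<^sup>2 * (norm x)\<^sup>2"
  define p where "p = lam * (x \<bullet> y)"
  define S where "S = sqrt (p\<^sup>2 + (norm y)\<^sup>2 * D)"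
  define F where "F = funk_metric lam x y"
  have D: "D > 0"
    unfolding D_def using funk_domain_weight_pos[OF assms] .
  have F: "D * F = S + p"
    using D by (simp add: F_def funk_metric_def S_def p_def D_def[symmetric] power_mult_distrib field_simps)
  have "\<bar>p\<bar> \<le> S"
    unfolding S_def using D by (intro real_le_rsqrt) auto
  then have "D * F \<ge> 0"
    using F by linarith
  then show Fnn: "funk_metric lam x y \<ge> 0"
    using D by (simp add: F_def zero_le_mult_iff)
  have "(D * F - p)\<^sup>2 = p\<^sup>2 + (norm y)\<^sup>2 * D"
    using F D by (simp add: S_def)
  then have "D * (D * F\<^sup>2 - 2 * p * F - (norm y)\<^sup>2) = 0"
    by (simp add: power2_eq_square algebra_simps)
  then have "D * F\<^sup>2 - 2 * p * F - (norm y)\<^sup>2 = 0"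
    using D by simp
  then have "(norm (y + (lam * F) *\<^sub>R x))\<^sup>2 = F\<^sup>2"
    unfolding power2_norm_eq_inner D_def p_def
    by (simp add: inner_add_left inner_add_right inner_commute[of y x] power2_eq_square algebra_simps)
  then show "norm (y + (lam * funk_metric lam x y) *\<^sub>R x) = funk_metric lam x y"
    using Fnn by (simp add: F_def)
qed

text \<open>The hypothesis on \<open>f\<close> is the same quadratic polynomial being nonnegative at \<open>f\<close>. This
  polynomial is convex, and at 0 it is at most 0, so a positive such \<open>f\<close> is at least its larger root.\<close>

lemma funk_metric_le:
  assumes "lam > 0" "x \<in> funk_domain lam" "f > 0" "norm (y + (lam * f) *\<^sub>R x) \<le> f"
  shows "funk_metric lam x y \<le> f"
proof -
  define D where "D = 1 - lam\<^sup>2 * (norm x)\<^sup>2"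
  define p where "p = lam * (x \<bullet> y)"
  have D: "D > 0"
    unfolding D_def using funk_domain_weight_pos[OF assms(1,2)] .
  have "(norm (y + (lam * f) *\<^sub>R x))\<^sup>2 \<le> f\<^sup>2"
    using assms by (intro power_mono) auto
  then have q: "D * f\<^sup>2 - 2 * p * f \<ge> (norm y)\<^sup>2"
    unfolding power2_norm_eq_inner D_def p_def
    by (simp add: inner_add_left inner_add_right inner_commute[of y x] power2_eq_square algebra_simps)
  moreover have "f * (D * f - 2 * p) = D * f\<^sup>2 - 2 * p * f"
    by (simp add: power2_eq_square algebra_simps)
  ultimately have "f * (D * f - 2 * p) \<ge> 0"
    using zero_le_power2[of "norm y"] by linarith
  then have "D * f - 2 * p \<ge> 0"
    using assms(3) by (simp add: zero_le_mult_iff)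
  moreover have "D * f > 0"
    using D assms(3) by simp
  ultimately have nn: "D * f - p \<ge> 0"
    by linarith
  have "D * (norm y)\<^sup>2 \<le> D * (D * f\<^sup>2 - 2 * p * f)"
    using q D by (intro mult_left_mono) auto
  then have "p\<^sup>2 + (norm y)\<^sup>2 * D \<le> (D * f - p)\<^sup>2"
    by (simp add: power2_eq_square algebra_simps)
  then have "sqrt (p\<^sup>2 + (norm y)\<^sup>2 * D) \<le> D * f - p"
    using nn real_le_lsqrt by blast
  then have "(sqrt (p\<^sup>2 + (norm y)\<^sup>2 * D) + p) / D \<le> f"
    using D by (simp add: field_simps)
  moreover have "funk_metric lam x y = (sqrt (p\<^sup>2 + (norm y)\<^sup>2 * D) + p) / D"
    by (simp add: funk_metric_def p_def D_def[symmetric] power_mult_distrib add_divide_distrib)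
  ultimately show ?thesis by simp
qed

lemma funk_metric_ge:
  assumes "lam > 0" "x \<in> funk_domain lam" "norm \<nu> = 1"
  shows "(y \<bullet> \<nu>) / (1 - lam * (x \<bullet> \<nu>)) \<le> funk_metric lam x y"
proof -
  define F where "F = funk_metric lam x y"
  have "(y + (lam * F) *\<^sub>R x) \<bullet> \<nu> \<le> norm (y + (lam * F) *\<^sub>R x) * norm \<nu>"
    by (rule norm_cauchy_schwarz)
  also have "\<dots> = F"
    using funk_metric_nonneg_indicatrix(2)[OF assms(1,2)] assms(3) by (simp add: F_def)
  finally have "y \<bullet> \<nu> \<le> F * (1 - lam * (x \<bullet> \<nu>))"
    by (simp add: inner_add_left algebra_simps)
  then show ?thesis
    using funk_domain_inner_less[OF assms] by (simp add: F_def divide_le_eq)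
qed

lemma continuous_on_funk_metric:
  assumes "lam > 0" "continuous_on S g" "continuous_on S h" "g ` S \<subseteq> funk_domain lam"
  shows "continuous_on S (\<lambda>t. funk_metric lam (g t) (h t))"
proof -
  have "\<forall>t\<in>S. 1 - lam\<^sup>2 * (norm (g t))\<^sup>2 \<noteq> 0"
    using funk_domain_weight_pos[OF assms(1)] assms(4) by fastforce
  then show ?thesis
    unfolding funk_metric_def using assms(2,3) by (auto intro!: continuous_intros)
qed

section \<open>Lengths of curves\<close>

text \<open>The curve may be one piece of a longer one on \<open>{\<alpha>..\<beta>}\<close>. The derivative of the whole curve
  and that of the piece agree except possibly at the two ends of the piece.\<close>

lemma regular_piece_length_ge:
  assumes lam: "lam > 0" and "u < v" and reg: "regular_on u v g"
    and dom: "g ` {u..v} \<subseteq> funk_domain lam" and nu: "norm \<nu> = 1"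
    and sub: "\<alpha> \<le> u" "v \<le> \<beta>"
  shows "\<exists>I. ((\<lambda>t. funk_metric lam (g t) (vector_derivative g (at t within {\<alpha>..\<beta>}))) has_integral I) {u..v}
     \<and> (ln (1 - lam * (g u \<bullet> \<nu>)) - ln (1 - lam * (g v \<bullet> \<nu>))) / lam \<le> I"
proof -
  obtain g' where g': "continuous_on {u..v} g'"
      "\<And>t. t \<in> {u..v} \<Longrightarrow> (g has_vector_derivative g' t) (at t within {u..v})"
    using reg unfolding regular_on_def by blast
  have contg: "continuous_on {u..v} g"
    using g'(2) by (meson continuous_on_vector_derivative)
  define I where "I = integral {u..v} (\<lambda>t. funk_metric lam (g t) (g' t))"
  have "(\<lambda>t. funk_metric lam (g t) (g' t)) integrable_on {u..v}"
    by (intro integrable_continuous_real continuous_on_funk_metric lam contg g'(1) dom)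
  then have I: "((\<lambda>t. funk_metric lam (g t) (g' t)) has_integral I) {u..v}"
    unfolding I_def by (rule integrable_integral)
  have spike: "((\<lambda>t. funk_metric lam (g t) (vector_derivative g (at t within {\<alpha>..\<beta>}))) has_integral I) {u..v}"
  proof (rule has_integral_spike_finite[OF _ _ I, of "{u, v}"])
    fix t assume t: "t \<in> {u..v} - {u, v}"
    then have "u < t" "t < v" by auto
    then have "at t within {\<alpha>..\<beta>} = at t" "at t within {u..v} = at t"
      using sub by (auto simp: at_within_Icc_at)
    then have "vector_derivative g (at t within {\<alpha>..\<beta>}) = g' t"
      using g'(2)[of t] t by (simp add: vector_derivative_at)
    then show "funk_metric lam (g t) (vector_derivative g (at t within {\<alpha>..\<beta>})) = funk_metric lam (g t) (g' t)"
      by simp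
  qed simp
  define \<Phi> where "\<Phi> t = - ln (1 - lam * (g t \<bullet> \<nu>)) / lam" for t
  have pos: "1 - lam * (g t \<bullet> \<nu>) > 0" if "t \<in> {u..v}" for t
    using funk_domain_inner_less[OF lam subsetD[OF dom imageI[OF that]] nu] by simp
  have "((\<lambda>t. (g' t \<bullet> \<nu>) / (1 - lam * (g t \<bullet> \<nu>))) has_integral (\<Phi> v - \<Phi> u)) {u..v}"
  proof (rule fundamental_theorem_of_calculus)
    show "u \<le> v" using \<open>u < v\<close> by simp
    fix t assume t: "t \<in> {u..v}"
    have "((\<lambda>t. g t \<bullet> \<nu>) has_real_derivative (g' t \<bullet> \<nu>)) (at t within {u..v})"
      using bounded_linear.has_vector_derivative[OF bounded_linear_inner_left g'(2)[OF t], of \<nu>]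
      by (simp add: has_real_derivative_iff_has_vector_derivative)
    then have "(\<Phi> has_real_derivative (g' t \<bullet> \<nu>) / (1 - lam * (g t \<bullet> \<nu>))) (at t within {u..v})"
      unfolding \<Phi>_def using pos[OF t] lam
      by (auto intro!: derivative_eq_intros simp: field_simps)
    then show "(\<Phi> has_vector_derivative (g' t \<bullet> \<nu>) / (1 - lam * (g t \<bullet> \<nu>))) (at t within {u..v})"
      by (simp add: has_real_derivative_iff_has_vector_derivative)
  qed
  then have "\<Phi> v - \<Phi> u \<le> I"
    using I
  proof (rule has_integral_le)
    fix t assume "t \<in> {u..v}"
    then have "g t \<in> funk_domain lam" using dom by blast
    then show "(g' t \<bullet> \<nu>) / (1 - lam * (g t \<bullet> \<nu>)) \<le> funk_metric lam (g t) (g' t)"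
      by (rule funk_metric_ge[OF lam _ nu])
  qed
  then show ?thesis
    using spike lam by (intro exI[of _ I]) (simp add: \<Phi>_def diff_divide_distrib)
qed

lemma funk_length_ge:
  assumes lam: "lam > 0" and pw: "piecewise_regular_on \<alpha> \<beta> g"
    and dom: "g ` {\<alpha>..\<beta>} \<subseteq> funk_domain lam" and nu: "norm \<nu> = 1"
  shows "(ln (1 - lam * (g \<alpha> \<bullet> \<nu>)) - ln (1 - lam * (g \<beta> \<bullet> \<nu>))) / lam \<le> funk_length lam \<alpha> \<beta> g"
proof -
  obtain n \<tau> where \<tau>: "\<tau> 0 = \<alpha>" "\<tau> n = \<beta>"
      "\<And>i. i < n \<Longrightarrow> \<tau> i < \<tau> (Suc i)" "\<And>i. i < n \<Longrightarrow> regular_on (\<tau> i) (\<tau> (Suc i)) g"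
    using pw unfolding piecewise_regular_on_def by blast
  have mono: "\<tau> i \<le> \<tau> j" if "i \<le> j" "j \<le> n" for i j
    using that
  proof (induction j rule: dec_induct)
    case (step j)
    then show ?case using \<tau>(3)[of j] by simp
  qed simp
  let ?f = "\<lambda>t. funk_metric lam (g t) (vector_derivative g (at t within {\<alpha>..\<beta>}))"
  let ?L = "\<lambda>t. ln (1 - lam * (g t \<bullet> \<nu>))"
  have "\<exists>I. (?f has_integral I) {\<alpha>..\<tau> i} \<and> (?L \<alpha> - ?L (\<tau> i)) / lam \<le> I" if "i \<le> n" for i
    using that
  proof (induction i)
    case 0
    show ?case
      using \<tau>(1) by (intro exI[of _ 0]) (simp add: has_integral_refl)
  next
    case (Suc i)
    then obtain I where I: "(?f has_integral I) {\<alpha>..\<tau> i}" "(?L \<alpha> - ?L (\<tau> i)) / lam \<le> I"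
      by auto
    have le: "\<alpha> \<le> \<tau> i" "\<tau> i < \<tau> (Suc i)" "\<tau> (Suc i) \<le> \<beta>"
      using mono[of 0 i] mono[of "Suc i" n] \<tau> Suc.prems by auto
    then have "g ` {\<tau> i..\<tau> (Suc i)} \<subseteq> funk_domain lam"
      using dom by auto
    then obtain J where J: "(?f has_integral J) {\<tau> i..\<tau> (Suc i)}"
        "(?L (\<tau> i) - ?L (\<tau> (Suc i))) / lam \<le> J"
      using regular_piece_length_ge[OF lam le(2) \<tau>(4) _ nu le(1,3)] Suc.prems by auto
    have "(?f has_integral (I + J)) {\<alpha>..\<tau> (Suc i)}"
      using has_integral_combine[OF le(1) less_imp_le[OF le(2)] I(1) J(1)] .
    moreover have "(?L \<alpha> - ?L (\<tau> (Suc i))) / lam \<le> I + J"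
      using I(2) J(2) by (simp add: diff_divide_distrib)
    ultimately show ?case by blast
  qed
  from this[of n] show ?thesis
    using \<tau>(2) by (auto simp: funk_length_def integral_unique)
qed

text \<open>The homothety of ratio \<open>1 / R\<close> that takes \<open>P\<close> to \<open>Q\<close> has as its centre the vector \<open>w\<close> with
  \<open>(R - 1) *\<^sub>R w = R *\<^sub>R Q - P\<close>, and the hypothesis on the norm says that \<open>w\<close> lies in the closed disc. Letting the ratio be \<open>exp (- (lam * u))\<close> gives a curve \<open>g\<close> with
  \<open>g' u + lam *\<^sub>R g u = lam *\<^sub>R w\<close>, so \<open>1\<close> satisfies the hypothesis of \<open>funk_metric_le\<close>.\<close>

lemma homothety_curve_length_le:
  assumes lam: "lam > 0" and P: "P \<in> funk_domain lam" and "P \<noteq> Q"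
    and "R > 1" and ball: "norm (R *\<^sub>R Q - P) \<le> (R - 1) / lam"
  shows "\<exists>\<alpha> \<beta> g. piecewise_regular_on \<alpha> \<beta> g \<and> g ` {\<alpha>..\<beta>} \<subseteq> funk_domain lam \<and> g \<alpha> = P \<and> g \<beta> = Q
     \<and> funk_length lam \<alpha> \<beta> g \<le> ln R / lam"
proof -
  define w where "w = (1 / (R - 1)) *\<^sub>R (R *\<^sub>R Q - P)"
  define g where "g u = w + exp (- (lam * u)) *\<^sub>R (P - w)" for u
  define g' where "g' u = (- lam * exp (- (lam * u))) *\<^sub>R (P - w)" for u
  define T where "T = ln R / lam"
  have T: "T > 0"
    using lam \<open>R > 1\<close> by (simp add: T_def)
  have w: "norm w \<le> 1 / lam"
  proof -
    have "norm w = norm (R *\<^sub>R Q - P) / (R - 1)"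
      using \<open>R > 1\<close> by (simp add: w_def)
    also have "\<dots> \<le> 1 / lam"
      using ball \<open>R > 1\<close> by (simp add: pos_divide_le_eq)
    finally show ?thesis .
  qed
  have Rw: "(R - 1) *\<^sub>R w = R *\<^sub>R Q - P"
    using \<open>R > 1\<close> by (simp add: w_def)
  have end1: "R *\<^sub>R (Q - w) = P - w"
    using Rw by (simp add: algebra_simps)
  have "P \<noteq> w"
  proof
    assume "P = w"
    with end1 have "Q = w" using \<open>R > 1\<close> by simp
    with \<open>P = w\<close> \<open>P \<noteq> Q\<close> show False by simp
  qed
  have gT: "g T = Q"
  proof -
    have "exp (- (lam * T)) = 1 / R"
      using lam \<open>R > 1\<close> by (simp add: T_def exp_minus inverse_eq_divide)
    then have "g T = w + (1 / R) *\<^sub>R (R *\<^sub>R (Q - w))"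
      by (simp add: g_def end1)
    then show ?thesis using \<open>R > 1\<close> by simp
  qed
  have g0: "g 0 = P" by (simp add: g_def)
  have dom: "g u \<in> funk_domain lam" if "u \<ge> 0" for u
  proof -
    define e where "e = exp (- (lam * u))"
    have e: "0 < e" "e \<le> 1"
      using that lam by (auto simp: e_def)
    have "g u = (1 - e) *\<^sub>R w + e *\<^sub>R P"
      by (simp add: g_def e_def algebra_simps)
    then have "norm (g u) \<le> (1 - e) * norm w + e * norm P"
      using norm_triangle_ineq[of "(1 - e) *\<^sub>R w" "e *\<^sub>R P"] e by simp
    also have "(1 - e) * norm w \<le> (1 - e) * (1 / lam)"
      using e w by (intro mult_left_mono) auto
    also have "e * norm P < e * (1 / lam)"
      using e P by (intro mult_strict_left_mono) (auto simp: funk_domain_def)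
    also have "(1 - e) * (1 / lam) + e * (1 / lam) = 1 / lam"
      by (simp add: algebra_simps diff_divide_distrib)
    finally show ?thesis by (simp add: funk_domain_def)
  qed
  have der: "(g has_vector_derivative g' t) (at t within S)" for t S
    unfolding g_def g'_def by (auto intro!: derivative_eq_intros simp: field_simps)
  have contg': "continuous_on S g'" for S
    unfolding g'_def by (intro continuous_intros)
  have contg: "continuous_on S g" for S
    unfolding g_def by (intro continuous_intros)
  have "regular_on 0 T g"
    unfolding regular_on_def using der contg' lam \<open>P \<noteq> w\<close>
    by (intro exI[of _ g']) (auto simp: g'_def)
  then have pw: "piecewise_regular_on 0 T g"
    unfolding piecewise_regular_on_def using T
    by (intro conjI exI[of _ 1] exI[of _ "\<lambda>i. if i = 0 then 0 else T"]) auto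
  have F: "funk_metric lam (g t) (g' t) \<le> 1" if "t \<ge> 0" for t
  proof (rule funk_metric_le[OF lam dom[OF that]])
    have "g' t + (lam * 1) *\<^sub>R g t = lam *\<^sub>R w"
      by (simp add: g_def g'_def algebra_simps)
    then show "norm (g' t + (lam * 1) *\<^sub>R g t) \<le> 1"
      using w lam by (simp add: field_simps)
  qed simp
  have "funk_length lam 0 T g = integral {0..T} (\<lambda>t. funk_metric lam (g t) (g' t))"
    unfolding funk_length_def
  proof (rule integral_cong)
    fix t assume "t \<in> {0..T}"
    then have "vector_derivative g (at t within {0..T}) = g' t"
      using vector_derivative_within_cbox[of 0 T t g "g' t"] T der by simp
    then show "funk_metric lam (g t) (vector_derivative g (at t within {0..T})) = funk_metric lam (g t) (g' t)"
      by simp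
  qed
  also have "\<dots> \<le> integral {0..T} (\<lambda>t. 1)"
    using F dom
    by (intro integral_le integrable_continuous_real continuous_on_funk_metric lam contg contg') auto
  also have "\<dots> = ln R / lam"
    using T by (simp add: T_def)
  finally have len: "funk_length lam 0 T g \<le> ln R / lam" .
  show ?thesis
    using pw dom g0 gT len by (intro exI[of _ 0] exI[of _ T] exI[of _ g]) auto
qed

section \<open>The Funk distance and its level sets\<close>

abbreviation funk_lengths :: "real \<Rightarrow> real ^ 2 \<Rightarrow> real ^ 2 \<Rightarrow> real set" where
  "funk_lengths lam P Q \<equiv> {funk_length lam \<alpha> \<beta> g | \<alpha> \<beta> g.
     piecewise_regular_on \<alpha> \<beta> g \<and> g ` {\<alpha>..\<beta>} \<subseteq> funk_domain lam \<and> g \<alpha> = P \<and> g \<beta> = Q}"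

lemma funk_dist_le:
  assumes lam: "lam > 0" and P: "P \<in> funk_domain lam"
    and "R \<ge> 1" and ball: "norm (R *\<^sub>R Q - P) \<le> (R - 1) / lam"
  shows "funk_dist lam P Q \<le> ln R / lam"
proof (cases "P = Q")
  case True
  then show ?thesis
    using lam \<open>R \<ge> 1\<close> by (simp add: funk_dist_def)
next
  case False
  then have "R > 1"
    using \<open>R \<ge> 1\<close> ball by (cases "R = 1") auto
  then obtain \<alpha> \<beta> g where g: "piecewise_regular_on \<alpha> \<beta> g" "g ` {\<alpha>..\<beta>} \<subseteq> funk_domain lam"
      "g \<alpha> = P" "g \<beta> = Q" "funk_length lam \<alpha> \<beta> g \<le> ln R / lam"
    using homothety_curve_length_le[OF lam P False _ ball] by blast
  obtain \<nu> :: "real ^ 2" where "norm \<nu> = 1"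
    using vector_choose_size[of 1] by auto
  then have "bdd_below (funk_lengths lam P Q)"
    using funk_length_ge[OF lam]
    by (intro bdd_belowI[of _ "(ln (1 - lam * (P \<bullet> \<nu>)) - ln (1 - lam * (Q \<bullet> \<nu>))) / lam"]) blast
  moreover have "funk_length lam \<alpha> \<beta> g \<in> funk_lengths lam P Q"
    using g by blast
  ultimately have "Inf (funk_lengths lam P Q) \<le> funk_length lam \<alpha> \<beta> g"
    by (rule cInf_lower[rotated])
  then show ?thesis
    using g(5) False by (simp add: funk_dist_def)
qed

lemma funk_dist_ge:
  assumes lam: "lam > 0" and P: "P \<in> funk_domain lam" and Q: "Q \<in> funk_domain lam"
    and nu: "norm \<nu> = 1"
  shows "(ln (1 - lam * (P \<bullet> \<nu>)) - ln (1 - lam * (Q \<bullet> \<nu>))) / lam \<le> funk_dist lam P Q"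
proof (cases "P = Q")
  case True
  then show ?thesis by (simp add: funk_dist_def)
next
  case False
  \<comment> \<open>For \<open>R\<close> this large the triangle inequality puts \<open>P\<close> into the disc around \<open>R *\<^sub>R Q\<close>. So the set of
    lengths is nonempty and its \<open>Inf\<close> is meaningful.\<close>
  define R where "R = max 2 ((norm P + 1 / lam) / (1 / lam - norm Q))"
  have "R \<ge> (norm P + 1 / lam) / (1 / lam - norm Q)"
    by (simp add: R_def)
  then have "norm P + 1 / lam \<le> R * (1 / lam - norm Q)"
    using Q by (simp add: funk_domain_def pos_divide_le_eq)
  moreover have "norm (R *\<^sub>R Q - P) \<le> R * norm Q + norm P"
    using norm_triangle_ineq4[of "R *\<^sub>R Q" P] by (simp add: R_def)
  ultimately have "norm (R *\<^sub>R Q - P) \<le> (R - 1) / lam"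
    by (simp add: algebra_simps diff_divide_distrib)
  moreover have "R > 1" by (simp add: R_def)
  ultimately have "funk_lengths lam P Q \<noteq> {}"
    using homothety_curve_length_le[OF lam P False] by blast
  then have "(ln (1 - lam * (P \<bullet> \<nu>)) - ln (1 - lam * (Q \<bullet> \<nu>))) / lam \<le> Inf (funk_lengths lam P Q)"
  proof (rule cInf_greatest)
    fix l assume "l \<in> funk_lengths lam P Q"
    then obtain \<alpha> \<beta> g where "piecewise_regular_on \<alpha> \<beta> g" "g ` {\<alpha>..\<beta>} \<subseteq> funk_domain lam"
        "g \<alpha> = P" "g \<beta> = Q" "l = funk_length lam \<alpha> \<beta> g"
      by blast
    then show "(ln (1 - lam * (P \<bullet> \<nu>)) - ln (1 - lam * (Q \<bullet> \<nu>))) / lam \<le> l"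
      using funk_length_ge[OF lam _ _ nu] by auto
  qed
  then show ?thesis
    using False by (simp add: funk_dist_def)
qed

text \<open>The lower bounds for all directions \<open>\<nu>\<close> say that \<open>R *\<^sub>R Q - P\<close> has component at most \<open>(R - 1) / lam\<close>
  in each direction, in particular in its own.\<close>

lemma norm_funk_dist_le:
  assumes lam: "lam > 0" and P: "P \<in> funk_domain lam" and Q: "Q \<in> funk_domain lam"
    and R: "R > 0" "funk_dist lam P Q \<le> ln R / lam"
  shows "norm (R *\<^sub>R Q - P) \<le> (R - 1) / lam"
proof -
  have *: "lam * ((R *\<^sub>R Q - P) \<bullet> \<nu>) \<le> R - 1" if nu: "norm \<nu> = 1" for \<nu>
  proof -
    have pos: "1 - lam * (P \<bullet> \<nu>) > 0" "1 - lam * (Q \<bullet> \<nu>) > 0"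
      using funk_domain_inner_less[OF lam _ nu] P Q by auto
    have "(ln (1 - lam * (P \<bullet> \<nu>)) - ln (1 - lam * (Q \<bullet> \<nu>))) / lam \<le> ln R / lam"
      using funk_dist_ge[OF lam P Q nu] R(2) by linarith
    then have "ln (1 - lam * (P \<bullet> \<nu>)) \<le> ln R + ln (1 - lam * (Q \<bullet> \<nu>))"
      using lam by (simp add: divide_le_cancel)
    also have "\<dots> = ln (R * (1 - lam * (Q \<bullet> \<nu>)))"
      using R(1) pos by (simp add: ln_mult)
    finally have "1 - lam * (P \<bullet> \<nu>) \<le> R * (1 - lam * (Q \<bullet> \<nu>))"
      using R(1) pos by simp
    then show ?thesis
      by (simp add: inner_diff_left algebra_simps)
  qed
  define v where "v = R *\<^sub>R Q - P"
  \<comment> \<open>For \<open>v = 0\<close> any unit vector gives \<open>R \<ge> 1\<close>.\<close>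
  obtain \<nu> where "norm \<nu> = 1" "v \<bullet> \<nu> = norm v"
  proof (cases "v = 0")
    case True
    obtain \<nu> :: "real ^ 2" where "norm \<nu> = 1"
      using vector_choose_size[of 1] by auto
    with True that show ?thesis by simp
  next
    case False
    then show ?thesis
      using that[of "sgn v"] by (simp add: norm_sgn sgn_div_norm power2_norm_eq_inner[symmetric] power2_eq_square)
  qed
  then show ?thesis
    using *[of \<nu>] lam by (simp add: v_def field_simps)
qed

section \<open>Distance from a line\<close>

text \<open>Here \<open>k\<close> and \<open>h\<close> stand for the signed distances of the line and of \<open>Q\<close> from the parallel through the
  origin. At parameter \<open>R\<close> the disc has its centre at height \<open>R * h\<close>, so it meets the line when
  \<open>\<bar>R * h - k\<bar> \<le> (R - 1) / lam\<close>. This amounts to two linear conditions on \<open>R\<close>, one for each side of the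
  line, and \<open>r\<close> is the larger of the two resulting bounds.\<close>

lemma funk_height_ratio:
  fixes lam h k r :: real
  assumes "lam > 0" "\<bar>lam * h\<bar> < 1"
    and "r = (1 - lam\<^sup>2 * k * h + lam * \<bar>k - h\<bar>) / (1 - lam\<^sup>2 * h\<^sup>2)"
  shows "\<bar>r * h - k\<bar> = (r - 1) / lam"
    and "\<And>R. \<bar>R * h - k\<bar> \<le> (R - 1) / lam \<Longrightarrow> r \<le> R"
proof -
  have pos: "1 - lam * h > 0" "1 + lam * h > 0"
    using assms(2) by linarith+
  have den: "1 - lam\<^sup>2 * h\<^sup>2 = (1 - lam * h) * (1 + lam * h)"
    by (simp add: power2_eq_square algebra_simps)
  \<comment> \<open>Of the two quotients, \<open>r\<close> is the one belonging to the side of the line on which \<open>h\<close> lies.\<close>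
  consider (up) "k \<le> h" "r = (1 - lam * k) / (1 - lam * h)"
    | (down) "h \<le> k" "r = (1 + lam * k) / (1 + lam * h)"
  proof (cases "k \<le> h")
    case True
    then have "1 - lam\<^sup>2 * k * h + lam * \<bar>k - h\<bar> = (1 - lam * k) * (1 + lam * h)"
      by (simp add: power2_eq_square algebra_simps)
    with True pos that(1) show ?thesis by (simp add: assms(3) den)
  next
    case False
    then have "1 - lam\<^sup>2 * k * h + lam * \<bar>k - h\<bar> = (1 + lam * k) * (1 - lam * h)"
      by (simp add: power2_eq_square algebra_simps)
    with False pos that(2) show ?thesis by (simp add: assms(3) den)
  qed
  note side = this
  have r1: "r \<ge> 1"
    using side by cases (use pos assms(1) in \<open>auto simp: pos_le_divide_eq\<close>)
  show "\<bar>r * h - k\<bar> = (r - 1) / lam"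
    using side
  proof cases
    case up
    then have "r * (1 - lam * h) = 1 - lam * k" using pos by simp
    then have "r * h - k = (r - 1) / lam" using assms(1) by (simp add: field_simps)
    then show ?thesis using r1 assms(1) by simp
  next
    case down
    then have "r * (1 + lam * h) = 1 + lam * k" using pos by simp
    then have "k - r * h = (r - 1) / lam" using assms(1) by (simp add: field_simps)
    moreover have "(r - 1) / lam \<ge> 0" using r1 assms(1) by simp
    ultimately show ?thesis by linarith
  qed
  show "r \<le> R" if "\<bar>R * h - k\<bar> \<le> (R - 1) / lam" for R
  proof -
    have "lam * (R * h - k) \<le> R - 1" "lam * (k - R * h) \<le> R - 1"
      using that assms(1) by (auto simp: abs_le_iff field_simps)
    then have "1 - lam * k \<le> R * (1 - lam * h)" "1 + lam * k \<le> R * (1 + lam * h)"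
      by (auto simp: algebra_simps)
    then have "(1 - lam * k) / (1 - lam * h) \<le> R" "(1 + lam * k) / (1 + lam * h) \<le> R"
      by (simp_all only: pos_divide_le_eq[OF pos(1)] pos_divide_le_eq[OF pos(2)])
    then show ?thesis
      using side(1) by blast
  qed
qed

text \<open>The pairs \<open>(P', R)\<close> with \<open>norm (R *\<^sub>R Q - P') \<le> (R - 1) / lam\<close> form a convex cone with apex \<open>(Q, 1)\<close>. If the
  minimizer \<open>P\<close> had a parameter \<open>R > r\<close>, the segment from \<open>(P, R)\<close> to \<open>(P0, r)\<close> would contain points
  near \<open>P\<close>, hence still in the open disc, with a smaller parameter.\<close>

lemma minimizer_at_tangency:
  assumes lam: "lam > 0" and Q: "Q \<in> funk_domain lam" and conv: "convex s"
    and min: "realizes_funk_dist_line lam s Q P"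
    and P0: "P0 \<in> s" "norm (r *\<^sub>R Q - P0) \<le> (r - 1) / lam"
    and least: "\<And>P' R. P' \<in> s \<Longrightarrow> norm (R *\<^sub>R Q - P') \<le> (R - 1) / lam \<Longrightarrow> r \<le> R"
    and unique: "\<And>P'. P' \<in> s \<Longrightarrow> norm (r *\<^sub>R Q - P') \<le> (r - 1) / lam \<Longrightarrow> P' = P0"
  shows "P = P0" and "funk_dist lam P Q = ln r / lam"
proof -
  have P: "P \<in> s" "P \<in> funk_domain lam"
    and le: "\<And>P'. P' \<in> s \<Longrightarrow> P' \<in> funk_domain lam \<Longrightarrow> funk_dist lam P Q \<le> funk_dist lam P' Q"
    using min by (auto simp: realizes_funk_dist_line_def)
  have "0 \<le> (r - 1) / lam"
    using P0(2) norm_ge_zero order_trans by blast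
  then have r1: "r \<ge> 1"
    using lam by (simp add: zero_le_divide_iff)
  define R where "R = exp (lam * funk_dist lam P Q)"
  have lnR: "funk_dist lam P Q = ln R / lam"
    using lam by (simp add: R_def)
  have ball: "norm (R *\<^sub>R Q - P) \<le> (R - 1) / lam"
    by (rule norm_funk_dist_le[OF lam P(2) Q _ eq_refl[OF lnR]]) (simp add: R_def)
  have rR: "r \<le> R"
    using least[OF P(1) ball] .
  have "R = r"
  proof (rule ccontr)
    assume "R \<noteq> r"
    with rR have "r < R" by simp
    have "open (funk_domain lam)"
      unfolding funk_domain_def by (intro open_Collect_less continuous_intros)
    then obtain d where d: "d > 0" "\<And>x. norm (x - P) < d \<Longrightarrow> x \<in> funk_domain lam"
      using P(2) by (metis dist_norm open_dist)
    \<comment> \<open>The summand 1 keeps the denominator positive when \<open>P0 = P\<close>.\<close>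
    define e where "e = min 1 (d / (2 * (norm (P0 - P) + 1)))"
    have e: "0 < e" "e \<le> 1"
      using d(1) by (auto simp: e_def add_nonneg_pos)
    have "e * norm (P0 - P) \<le> e * (norm (P0 - P) + 1)"
      using e by (simp add: mult_left_mono)
    also have "\<dots> \<le> d / (2 * (norm (P0 - P) + 1)) * (norm (P0 - P) + 1)"
      by (intro mult_right_mono) (auto simp: e_def)
    also have "\<dots> = d / 2"
      by (simp add: field_simps add_nonneg_eq_0_iff)
    also have "\<dots> < d" using d(1) by simp
    finally have small: "e * norm (P0 - P) < d" .
    define P' where "P' = (1 - e) *\<^sub>R P + e *\<^sub>R P0"
    define R' where "R' = (1 - e) * R + e * r"
    have "P' - P = e *\<^sub>R (P0 - P)" by (simp add: P'_def algebra_simps)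
    then have P'dom: "P' \<in> funk_domain lam"
      using small e by (intro d(2)) simp
    have P's: "P' \<in> s"
      unfolding P'_def using conv P(1) P0(1) e by (intro convexD) auto
    have "R' \<ge> (1 - e) * 1 + e * 1"
      unfolding R'_def using e r1 rR by (intro add_mono mult_left_mono) auto
    then have R'1: "R' \<ge> 1" by simp
    have "R - R' = e * (R - r)" by (simp add: R'_def algebra_simps)
    then have R'R: "R' < R" using e \<open>r < R\<close> by (metis diff_gt_0_iff_gt mult_pos_pos)
    have "R' *\<^sub>R Q - P' = (1 - e) *\<^sub>R (R *\<^sub>R Q - P) + e *\<^sub>R (r *\<^sub>R Q - P0)"
      by (simp add: R'_def P'_def algebra_simps)
    then have "norm (R' *\<^sub>R Q - P') \<le> (1 - e) * norm (R *\<^sub>R Q - P) + e * norm (r *\<^sub>R Q - P0)"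
      using norm_triangle_ineq[of "(1 - e) *\<^sub>R (R *\<^sub>R Q - P)" "e *\<^sub>R (r *\<^sub>R Q - P0)"] e by simp
    also have "\<dots> \<le> (1 - e) * ((R - 1) / lam) + e * ((r - 1) / lam)"
      using e ball P0(2) by (intro add_mono mult_left_mono) auto
    also have "\<dots> = (R' - 1) / lam"
      using lam by (simp add: R'_def field_simps)
    finally have "funk_dist lam P' Q \<le> ln R' / lam"
      by (rule funk_dist_le[OF lam P'dom R'1])
    also have "\<dots> < ln R / lam"
      using lam R'1 R'R by (simp add: divide_strict_right_mono)
    finally show False
      using le[OF P's P'dom] lnR by simp
  qed
  then show "P = P0" "funk_dist lam P Q = ln r / lam"
    using unique[OF P(1)] ball lnR by auto
qed

theorem theorem6:
  fixes lam a b m c \<theta> r :: real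
    and s :: "(real ^ 2) set"
    and Q Pstar :: "real ^ 2"
  assumes "lam > 0"
    and "Q = vector [a, b]"
    and "Q \<in> funk_domain lam"
    and "s = {p. p $ 2 = m * p $ 1 + c}"
    and "s \<inter> funk_domain lam \<noteq> {}"
    and "\<theta> = arctan m"
    and "r = (1 - lam\<^sup>2 * c * cos \<theta> * (b * cos \<theta> - a * sin \<theta>)
                + lam * \<bar>c * cos \<theta> - b * cos \<theta> + a * sin \<theta>\<bar>)
             / (1 - lam\<^sup>2 * (b * cos \<theta> - a * sin \<theta>)\<^sup>2)"
    and "Pstar = (vector [vector [cos \<theta>, - sin \<theta>], vector [sin \<theta>, cos \<theta>]] :: real ^ 2 ^ 2)
                 *v (vector [a * r * cos \<theta> + b * r * sin \<theta>, c * cos \<theta>] :: real ^ 2)"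
    and min_exists: "\<exists>P. realizes_funk_dist_line lam s Q P"
  shows "funk_dist_line lam s Q = ln r / lam \<and> realizes_funk_dist_line lam s Q Pstar"
proof -
  note lam = assms(1) and Q = assms(3)
  define h where "h = b * cos \<theta> - a * sin \<theta>"
  define k where "k = c * cos \<theta>"
  define t where "t = a * cos \<theta> + b * sin \<theta>"
  \<comment> \<open>Coordinates rotated by \<open>\<theta>\<close>: \<open>H\<close> is constant on \<open>s\<close>, and \<open>T\<close> runs along it.\<close>
  define H where "H p = cos \<theta> * p $ 2 - sin \<theta> * p $ 1" for p :: "real ^ 2"
  define T where "T p = cos \<theta> * p $ 1 + sin \<theta> * p $ 2" for p :: "real ^ 2"
  have unit: "sin \<theta> * sin \<theta> + cos \<theta> * cos \<theta> = 1"
    using sin_cos_squared_add[of \<theta>] by (simp add: power2_eq_square)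
  have cs: "cos \<theta> \<noteq> 0" "sin \<theta> = m * cos \<theta>"
  proof -
    show "cos \<theta> \<noteq> 0"
      using cos_arctan_not_zero[of m] by (simp only: assms(6) not_False_eq_True)
    moreover have "sin \<theta> / cos \<theta> = m"
      using tan_arctan[of m] unfolding assms(6) tan_def .
    ultimately show "sin \<theta> = m * cos \<theta>"
      by (metis nonzero_eq_divide_eq)
  qed
  have norm_HT: "(norm p)\<^sup>2 = (H p)\<^sup>2 + (T p)\<^sup>2" for p
  proof -
    have "(H p)\<^sup>2 + (T p)\<^sup>2 = (sin \<theta> * sin \<theta> + cos \<theta> * cos \<theta>) * (p $ 1 * p $ 1 + p $ 2 * p $ 2)"
      unfolding H_def T_def by algebra
    then have "(H p)\<^sup>2 + (T p)\<^sup>2 = p $ 1 * p $ 1 + p $ 2 * p $ 2"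
      by (simp only: unit mult_1)
    then show ?thesis
      by (simp add: power2_norm_eq_inner inner_vec_def sum_2)
  qed
  have lin: "H (x *\<^sub>R p - q) = x * H p - H q" "T (x *\<^sub>R p - q) = x * T p - T q" for x p q
    by (simp_all add: H_def T_def algebra_simps)
  have HT_eq: "p = q" if "H p = H q" "T p = T q" for p q
    using norm_HT[of "p - q"] lin[of 1 p q] that by simp
  have s_iff: "p \<in> s \<longleftrightarrow> H p = k" for p
  proof -
    have "H p - k = cos \<theta> * (p $ 2 - (m * p $ 1 + c))"
      by (simp add: H_def k_def cs(2) algebra_simps)
    then show ?thesis using cs(1) by (auto simp: assms(4))
  qed
  have HTQ: "H Q = h" "T Q = t"
    by (simp_all add: H_def T_def h_def t_def assms(2) algebra_simps)
  have Pstar: "Pstar $ 1 = cos \<theta> * (r * t) - sin \<theta> * k" "Pstar $ 2 = sin \<theta> * (r * t) + cos \<theta> * k"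
    by (simp_all add: assms(8) matrix_vector_mult_def sum_2 t_def k_def algebra_simps)
  have "H Pstar = (sin \<theta> * sin \<theta> + cos \<theta> * cos \<theta>) * k"
    "T Pstar = (sin \<theta> * sin \<theta> + cos \<theta> * cos \<theta>) * (r * t)"
    unfolding H_def T_def Pstar by algebra+
  then have HTP: "H Pstar = k" "T Pstar = r * t"
    by (simp_all only: unit mult_1)
  have H_le: "\<bar>H p\<bar> \<le> norm p" for p
    using norm_HT[of p] by (metis abs_le_square_iff abs_norm_cancel le_add_same_cancel1 zero_le_power2)
  have "lam * norm Q < 1"
    using Q lam by (simp add: funk_domain_def field_simps)
  moreover have "lam * \<bar>h\<bar> \<le> lam * norm Q"
    using H_le[of Q] HTQ lam by (simp add: mult_left_mono)
  ultimately have "lam * \<bar>h\<bar> < 1"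
    by linarith
  then have "\<bar>lam * h\<bar> < 1"
    using lam by (simp add: abs_mult)
  moreover have "r = (1 - lam\<^sup>2 * k * h + lam * \<bar>k - h\<bar>) / (1 - lam\<^sup>2 * h\<^sup>2)"
    by (simp add: assms(7) h_def k_def algebra_simps)
  ultimately have r: "\<bar>r * h - k\<bar> = (r - 1) / lam"
      "\<And>R. \<bar>R * h - k\<bar> \<le> (R - 1) / lam \<Longrightarrow> r \<le> R"
    using funk_height_ratio[OF lam] by blast+
  have conv: "convex s"
  proof (rule convexI)
    fix x y :: "real ^ 2" and u v :: real
    assume "x \<in> s" "y \<in> s" "u + v = 1"
    have "H (u *\<^sub>R x + v *\<^sub>R y) = u * H x + v * H y"
      by (simp add: H_def algebra_simps)
    also have "\<dots> = (u + v) * k"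
      using \<open>x \<in> s\<close> \<open>y \<in> s\<close> by (simp add: s_iff algebra_simps)
    finally show "u *\<^sub>R x + v *\<^sub>R y \<in> s" using \<open>u + v = 1\<close> by (simp add: s_iff)
  qed
  obtain P where P: "realizes_funk_dist_line lam s Q P"
    using min_exists by blast
  have Pstar_s: "Pstar \<in> s"
    by (simp add: s_iff HTP)
  have tangent: "norm (r *\<^sub>R Q - Pstar) \<le> (r - 1) / lam"
  proof -
    have "(norm (r *\<^sub>R Q - Pstar))\<^sup>2 = (r * h - k)\<^sup>2"
      by (simp add: norm_HT lin HTP HTQ)
    then have "norm (r *\<^sub>R Q - Pstar) = \<bar>r * h - k\<bar>"
      by (metis abs_norm_cancel power2_eq_iff_nonneg abs_ge_zero power2_abs)
    then show ?thesis
      using r(1) by simp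
  qed
  have least: "r \<le> R" if "P' \<in> s" "norm (R *\<^sub>R Q - P') \<le> (R - 1) / lam" for P' R
  proof -
    have "\<bar>R * h - k\<bar> \<le> (R - 1) / lam"
      using H_le[of "R *\<^sub>R Q - P'"] that by (simp add: lin HTQ s_iff)
    then show "r \<le> R" by (rule r(2))
  qed
  \<comment> \<open>The difference of heights already uses up the whole radius, so the components along \<open>s\<close> agree.\<close>
  have unique: "P' = Pstar" if P': "P' \<in> s" "norm (r *\<^sub>R Q - P') \<le> (r - 1) / lam" for P'
  proof -
    have "norm (r *\<^sub>R Q - P') \<le> \<bar>r * h - k\<bar>"
      using r(1) P'(2) by simp
    then have "(norm (r *\<^sub>R Q - P'))\<^sup>2 \<le> (r * h - k)\<^sup>2"
      by (metis norm_ge_zero power2_abs power_mono)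
    then have "T P' = r * t"
      using P'(1) by (simp add: norm_HT lin HTQ s_iff)
    then show "P' = Pstar"
      using P'(1) by (intro HT_eq) (simp_all add: HTP s_iff)
  qed
  note minimizer_at_tangency[OF lam Q conv P Pstar_s tangent least unique]
  then have Pstar_min: "realizes_funk_dist_line lam s Q Pstar" "funk_dist lam Pstar Q = ln r / lam"
    using P by auto
  have "funk_dist_line lam s Q = ln r / lam"
    unfolding funk_dist_line_def
  proof (rule Least_equality)
    show "ln r / lam \<in> (\<lambda>P. funk_dist lam P Q) ` (s \<inter> funk_domain lam)"
      using Pstar_min by (intro rev_image_eqI[of Pstar]) (auto simp: realizes_funk_dist_line_def)
  qed (use Pstar_min in \<open>auto simp: realizes_funk_dist_line_def\<close>)
  then show ?thesis using Pstar_min by simp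
qed

end
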